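(* Let $V$ be a valuation domain of rank one with quotient field $K$ and associated valuation $v$. Let $\beta\in\overline{K}$, where $\overline{K}$ is an algebraic closure of $K$, and let $u$ be an extension of $v$ to $\overline{K}$. Then $\mathcal{V}^u(\beta,\bullet)$ is closed in $\mathcal{V}$ with respect to the Zariski topology.
   Context: $\mathrm{Zar}(K(X)|V)$ is the set of valuation domains of $K(X)$ (with quotient field $K(X)$) containing $V$; its Zariski topology is generated by the subbasic open sets $B(\phi)=\{W\mid\phi\in W\}$, $\phi\in K(X)$. A sequence $E=\{s_n\}_{n\in\mathbb{N}}$ in $K$ is pseudo-convergent if $v(s_{n+1}-s_n)<v(s_{n+2}-s_{n+1})$ for all $n$. $V_E=\{\phi\in K(X)\mid \phi(s_n)\in V\text{ for all but finitely many }n\in\mathbb{N}\}$ is a valuation domain of $K(X)$ with $V_E\cap K=V$. $\mathcal{V}$ is the set of all rings $V_E$, $E$ a pseudo-convergent sequence in $K$, with the topology induced by the Zariski topology of $\mathrm{Zar}(K(X)|V)$. $\mathcal{L}_E^u$ is the set of pseudo-limits of $E$ in $\overline{K}$ with respect to $u$, i.e., of the $\alpha\in\overline{K}$ such that $u(\alpha-s_n)<u(\alpha-s_{n+1})$ for all $n$. $\mathcal{V}^u(\beta,\bullet)=\{V_E\in\mathcal{V}\mid\beta\in\mathcal{L}_E^u\}$. *)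

theory Defs
  imports
    "HOL-Analysis.Abstract_Topology"
    "HOL-Algebra.Algebraic_Closure_Type"
    "HOL-Library.Extended"
    "HOL-Library.Extended_Nat"
begin

text \<open>The base field \<open>K\<close> is a type \<open>'a :: field\<close>, so that \<open>K(X)\<close> is \<open>'a poly fract\<close> and the
  algebraic closure of \<open>K\<close> is \<open>'a alg_closure\<close>, with embedding \<^const>\<open>to_ac\<close>.
  Subrings of a field type are handled as sets.\<close>

text \<open>The condition on inverses also forces the ambient field to be the quotient field of \<open>D\<close>.\<close>
definition valuation_domain :: "'f::field set \<Rightarrow> bool" where
  "valuation_domain D \<longleftrightarrow>
     subring D ring_of_type_algebra \<and> (\<forall>x. x \<noteq> 0 \<longrightarrow> x \<in> D \<or> inverse x \<in> D)"

definition krull_dim :: "('r, 'm) ring_scheme \<Rightarrow> enat" where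
  "krull_dim R = Sup {enat n | n. \<exists>P :: nat \<Rightarrow> 'r set.
     (\<forall>i\<le>n. primeideal (P i) R) \<and> (\<forall>i<n. P i \<subset> P (Suc i))}"

text \<open>The rank of a valuation domain is its Krull dimension.\<close>
definition valuation_rank :: "'f::field set \<Rightarrow> enat" where
  "valuation_rank D = krull_dim (ring_of_type_algebra\<lparr>carrier := D\<rparr>)"

text \<open>Valuations are written additively, with values in an arbitrary linearly ordered abelian
  group \<open>'g\<close> together with \<open>\<infinity>\<close>. The type \<open>'g extended\<close> also has an element \<open>-\<infinity>\<close>, which is
  excluded as a value. The value group may be a proper subgroup of \<open>'g\<close>; this lets a valuation
  and its extensions share one type of values.\<close>
definition is_valuation :: "('f::field \<Rightarrow> 'g::linordered_ab_group_add extended) \<Rightarrow> bool" where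
  "is_valuation v \<longleftrightarrow>
     (\<forall>x. v x \<noteq> Minf) \<and>
     (\<forall>x. v x = Pinf \<longleftrightarrow> x = 0) \<and>
     (\<forall>x y. v (x * y) = v x + v y) \<and>
     (\<forall>x y. min (v x) (v y) \<le> v (x + y))"

definition associated_valuation ::
    "'f::field set \<Rightarrow> ('f \<Rightarrow> 'g::linordered_ab_group_add extended) \<Rightarrow> bool" where
  "associated_valuation D v \<longleftrightarrow> is_valuation v \<and> D = {x. 0 \<le> v x}"

definition extends_valuation ::
    "('a::field alg_closure \<Rightarrow> 'g::linordered_ab_group_add extended) \<Rightarrow> ('a \<Rightarrow> 'g extended) \<Rightarrow> bool" where
  "extends_valuation u v \<longleftrightarrow> is_valuation u \<and> (\<forall>x. u (to_ac x) = v x)"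

definition Zar :: "'a::field set \<Rightarrow> 'a poly fract set set" where
  "Zar V = {W. valuation_domain W \<and> (\<forall>c\<in>V. to_fract [:c:] \<in> W)}"

text \<open>The underlying set is all of \<open>Zar V\<close>, because every \<open>W\<close> contains \<open>1\<close>.\<close>
definition zariski_topology :: "'a::field set \<Rightarrow> 'a poly fract set topology" where
  "zariski_topology V = topology_generated_by {{W \<in> Zar V. \<phi> \<in> W} | \<phi>. True}"

definition pseudo_convergent ::
    "('a::field \<Rightarrow> 'g::linordered_ab_group_add extended) \<Rightarrow> (nat \<Rightarrow> 'a) \<Rightarrow> bool" where
  "pseudo_convergent v s \<longleftrightarrow>
     (\<forall>n. v (s (n + 1) - s n) < v (s (n + 2) - s (n + 1)))"

text \<open>\<open>has_value \<phi> a y\<close>: the rational function \<open>\<phi>\<close> is defined at \<open>a\<close> and \<open>\<phi>(a) = y\<close>.\<close>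
definition has_value :: "'a::field poly fract \<Rightarrow> 'a \<Rightarrow> 'a \<Rightarrow> bool" where
  "has_value \<phi> a y \<longleftrightarrow> (\<exists>p q. \<phi> = Fract p q \<and> poly q a \<noteq> 0 \<and> y = poly p a / poly q a)"

definition V_seq :: "'a::field set \<Rightarrow> (nat \<Rightarrow> 'a) \<Rightarrow> 'a poly fract set" where
  "V_seq V s = {\<phi>. \<forall>\<^sub>\<infinity>n. \<exists>y\<in>V. has_value \<phi> (s n) y}"

definition pseudo_limits ::
    "('a::field alg_closure \<Rightarrow> 'g::linordered_ab_group_add extended) \<Rightarrow> (nat \<Rightarrow> 'a) \<Rightarrow> 'a alg_closure set" where
  "pseudo_limits u s = {\<alpha>. \<forall>n. u (\<alpha> - to_ac (s n)) < u (\<alpha> - to_ac (s (n + 1)))}"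

definition pc_extensions ::
    "'a::field set \<Rightarrow> ('a \<Rightarrow> 'g::linordered_ab_group_add extended) \<Rightarrow> 'a poly fract set set" where
  "pc_extensions V v = {V_seq V s | s. pseudo_convergent v s}"

definition pc_topology ::
    "'a::field set \<Rightarrow> ('a \<Rightarrow> 'g::linordered_ab_group_add extended) \<Rightarrow> 'a poly fract set topology" where
  "pc_topology V v = subtopology (zariski_topology V) (pc_extensions V v)"

text \<open>The set \<open>\<V>\<^sup>u(\<beta>, \<bullet>)\<close>.\<close>
definition pc_extensions_at ::
    "'a::field set \<Rightarrow> ('a \<Rightarrow> 'g::linordered_ab_group_add extended) \<Rightarrow>
     ('a alg_closure \<Rightarrow> 'g extended) \<Rightarrow> 'a alg_closure \<Rightarrow> 'a poly fract set set" where
  "pc_extensions_at V v u \<beta> = {V_seq V s | s. pseudo_convergent v s \<and> \<beta> \<in> pseudo_limits u s}"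

end

theory Submission
  imports Defs
begin

text \<open>If \<open>\<beta>\<close> is not a pseudo-limit of \<open>E = {s\<^sub>n}\<close>, then some \<open>n\<close> satisfies
  \<open>u(\<beta> - s\<^sub>n) < v(s\<^sub>n\<^sub>+\<^sub>1 - s\<^sub>n)\<close>. The function \<open>\<phi> = (X - s\<^sub>n) / (s\<^sub>n\<^sub>+\<^sub>1 - s\<^sub>n)\<close> lies in \<open>V\<^sub>E\<close>, and
  if \<open>\<phi> \<in> V\<^sub>F\<close> for \<open>F = {t\<^sub>m}\<close>, then \<open>v(t\<^sub>m - s\<^sub>n) \<ge> v(s\<^sub>n\<^sub>+\<^sub>1 - s\<^sub>n)\<close> for large \<open>m\<close>, so that
  \<open>u(\<beta> - t\<^sub>m) = u(\<beta> - s\<^sub>n)\<close> does not increase and \<open>\<beta>\<close> is not a pseudo-limit of \<open>F\<close> either.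
  Hence \<open>B(\<phi>)\<close> is a neighbourhood of \<open>V\<^sub>E\<close> that misses the set.

  That each \<open>V\<^sub>E\<close> is a valuation domain follows by factoring polynomials over the algebraic closure:
  with \<open>\<gamma>\<^sub>n = v(s\<^sub>n\<^sub>+\<^sub>1 - s\<^sub>n)\<close>, the value of a nonzero polynomial at \<open>s\<^sub>n\<close> is eventually
  \<open>c + k \<gamma>\<^sub>n\<close>, and two such sequences are eventually comparable.\<close>

section \<open>Valuations\<close>

context
  fixes w :: "'f::field \<Rightarrow> 'g::linordered_ab_group_add extended"
  assumes w: "is_valuation w"
begin

lemma valuation_mult: "w (x * y) = w x + w y"
  using w by (auto simp: is_valuation_def)

lemma valuation_add: "min (w x) (w y) \<le> w (x + y)"
  using w by (auto simp: is_valuation_def)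

lemma valuation_zero [simp]: "w 0 = \<infinity>"
  using w by (auto simp: is_valuation_def)

lemma valuation_FinE:
  assumes "x \<noteq> 0"
  obtains a where "w x = Fin a"
  using w assms by (cases "w x") (auto simp: is_valuation_def)

lemma valuation_one [simp]: "w 1 = 0"
proof -
  obtain a where a: "w 1 = Fin a" by (rule valuation_FinE[of 1]) auto
  with valuation_mult[of 1 1] show ?thesis by (simp add: zero_extended_def)
qed

text \<open>The value \<open>a\<close> of \<open>- 1\<close> satisfies \<open>a + a = 0\<close>, and
  a linearly ordered group has no torsion.\<close>

lemma valuation_uminus [simp]: "w (- x) = w x"
proof -
  obtain a where a: "w (- 1) = Fin a" by (rule valuation_FinE[of "-1"]) auto
  have "Fin (a + a) = w ((- 1) * (- 1))" by (simp only: valuation_mult a plus_extended.simps)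
  then have "a + a = 0" by (simp add: zero_extended_def)
  then have "w (- 1) = 0" by (simp add: a zero_extended_def)
  then show ?thesis using valuation_mult[of "- 1" x] by simp
qed

lemma valuation_minus_commute: "w (x - y) = w (y - x)"
  using valuation_uminus[of "x - y"] by simp

text \<open>Otherwise \<open>x = (x + y) - y\<close> would be a sum of two terms of value greater
  than \<open>w x\<close>.\<close>

lemma valuation_add_eq_left:
  assumes "w x < w y"
  shows "w (x + y) = w x"
proof (rule antisym)
  show "w x \<le> w (x + y)" using valuation_add[of x y] assms by simp
  have "min (w (x + y)) (w y) \<le> w x" using valuation_add[of "x + y" "- y"] by simp
  then show "w (x + y) \<le> w x" using assms by (auto simp: min_def split: if_splits)
qed

lemma valuation_div_nonneg_iff:
  assumes "y \<noteq> 0"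
  shows "0 \<le> w (x / y) \<longleftrightarrow> w y \<le> w x"
proof -
  obtain b where b: "w y = Fin b" using assms by (rule valuation_FinE)
  have "w x = w (x / y) + w y" using valuation_mult[of "x / y" y] assms by simp
  moreover have "w (x / y) \<noteq> -\<infinity>" using w by (auto simp: is_valuation_def)
  ultimately show ?thesis using b by (cases "w (x / y)") (auto simp: zero_extended_def)
qed

section \<open>Pseudo-convergent sequences\<close>

lemma pseudo_convergent_gauge_strict_mono:
  assumes "pseudo_convergent w s"
  shows "strict_mono (\<lambda>n. w (s (Suc n) - s n))"
  using assms by (auto simp: pseudo_convergent_def strict_mono_Suc_iff)

text \<open>In the telescoping sum of consecutive differences from \<open>m\<close> to
  \<open>n\<close>, the first one has strictly the smallest value.\<close>

lemma pseudo_convergent_diff: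
  assumes "pseudo_convergent w s" "m < n"
  shows "w (s n - s m) = w (s (Suc m) - s m)"
proof -
  have "Suc m \<le> n" using assms(2) by simp
  then show ?thesis
  proof (induction n rule: dec_induct)
    case (step k)
    have "w (s (Suc m) - s m) < w (s (Suc k) - s k)"
      using strict_monoD[OF pseudo_convergent_gauge_strict_mono[OF assms(1)], of m k] step.hyps by simp
    then have "w ((s k - s m) + (s (Suc k) - s k)) = w (s k - s m)"
      by (intro valuation_add_eq_left) (simp add: step.IH)
    then show ?case by (simp add: step.IH)
  qed simp
qed

text \<open>Each gauge lies strictly below the next one, so none is \<infinity>; the gauges can then
  be handled inside the group \<open>'g\<close>.\<close>

lemma pseudo_convergent_gauge_FinE:
  assumes "pseudo_convergent w s"
  obtains g where "mono g" "\<And>n. w (s (Suc n) - s n) = Fin (g n)"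
proof -
  note sm = pseudo_convergent_gauge_strict_mono[OF assms]
  have "\<exists>a. w (s (Suc n) - s n) = Fin a" for n
    using strict_monoD[OF sm lessI[of n]] valuation_FinE by (metis less_extended_simps(4) valuation_zero)
  then obtain g where g: "\<And>n. w (s (Suc n) - s n) = Fin (g n)" by metis
  have "mono g" using strict_mono_mono[OF sm] by (simp add: g mono_def)
  with g show ?thesis using that by blast
qed

end

text \<open>If the second alternative fails, then
  \<open>\<alpha> - s\<^sub>n\<^sub>+\<^sub>1\<close> has value at least
  \<open>\<gamma>\<^sub>n\<^sub>+\<^sub>1 > \<gamma>\<^sub>n\<close>, so
  \<open>s\<^sub>n\<^sub>+\<^sub>1 - s\<^sub>n\<close> alone determines the value of
  \<open>\<alpha> - s\<^sub>n\<close>.\<close>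

lemma pseudo_limit_dichotomy:
  assumes v: "is_valuation v" and u: "extends_valuation u v" and s: "pseudo_convergent v s"
  shows "(\<forall>n. u (\<alpha> - to_ac (s n)) = v (s (Suc n) - s n)) \<or>
    (\<exists>n. u (\<alpha> - to_ac (s n)) < v (s (Suc n) - s n))"
proof (rule disjCI)
  assume "\<not> (\<exists>n. u (\<alpha> - to_ac (s n)) < v (s (Suc n) - s n))"
  then have ge: "v (s (Suc n) - s n) \<le> u (\<alpha> - to_ac (s n))" for n by (simp add: not_less)
  have u': "is_valuation u" and uv: "u (to_ac x) = v x" for x
    using u by (auto simp: extends_valuation_def)
  show "\<forall>n. u (\<alpha> - to_ac (s n)) = v (s (Suc n) - s n)"
  proof
    fix n
    have "u (to_ac (s (Suc n) - s n)) < u (\<alpha> - to_ac (s (Suc n)))"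
      using strict_monoD[OF pseudo_convergent_gauge_strict_mono[OF v s] lessI[of n]] ge[of "Suc n"]
      by (simp add: uv del: to_ac_diff)
    from valuation_add_eq_left[OF u' this]
    show "u (\<alpha> - to_ac (s n)) = v (s (Suc n) - s n)"
      by (simp flip: uv)
  qed
qed

text \<open>The sum of \<open>k\<close> copies of \<open>g n\<close> stands for the multiple
  \<open>k \<gamma>\<^sub>n\<close>. The two cases of the dichotomy give \<open>k = 1\<close> with
  \<open>c = 0\<close>, and \<open>k = 0\<close> with a constant value.\<close>

lemma valuation_at_root_eventually:
  assumes v: "is_valuation v" and u: "extends_valuation u v" and s: "pseudo_convergent v s"
    and g: "\<And>n. v (s (Suc n) - s n) = Fin (g n)"
  shows "\<exists>c k. \<forall>\<^sub>\<infinity>n. u (to_ac (s n) - \<alpha>) = Fin (c + (\<Sum>i<(k::nat). g n))"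
proof -
  have u': "is_valuation u" and uv: "u (to_ac x) = v x" for x
    using u by (auto simp: extends_valuation_def)
  from pseudo_limit_dichotomy[OF v u s, of \<alpha>] show ?thesis
  proof (elim disjE exE)
    assume "\<forall>n. u (\<alpha> - to_ac (s n)) = v (s (Suc n) - s n)"
    then show ?thesis
      by (intro exI[of _ 0] exI[of _ 1]) (simp add: g valuation_minus_commute[OF u', of \<alpha>])
  next
    fix n assume n: "u (\<alpha> - to_ac (s n)) < v (s (Suc n) - s n)"
    then have "\<alpha> - to_ac (s n) \<noteq> 0" using valuation_zero[OF u'] by (metis less_extended_simps(4))
    then obtain c where c: "u (\<alpha> - to_ac (s n)) = Fin c" by (rule valuation_FinE[OF u'])
    have "u (to_ac (s m) - \<alpha>) = Fin c" if "m > n" for m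
    proof -
      \<comment> \<open>Since \<open>s\<^sub>n - s\<^sub>m\<close> has value
        \<open>\<gamma>\<^sub>n\<close>, adding it to \<open>\<alpha> - s\<^sub>n\<close> does not
        change the value.\<close>
      have "u (\<alpha> - to_ac (s n)) < u (to_ac (s n - s m))"
        using n valuation_minus_commute[OF v, of "s n"] pseudo_convergent_diff[OF v s that]
        by (simp add: uv del: to_ac_diff)
      from valuation_add_eq_left[OF u' this] have "u (\<alpha> - to_ac (s m)) = Fin c" by (simp add: c)
      then show ?thesis by (simp only: valuation_minus_commute[OF u', of "to_ac (s m)"])
    qed
    then have "\<forall>\<^sub>\<infinity>m. u (to_ac (s m) - \<alpha>) = Fin c"
      unfolding MOST_nat by blast
    then show ?thesis by (intro exI[of _ c] exI[of _ 0]) simp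
  qed
qed

section \<open>Values of polynomials along a pseudo-convergent sequence\<close>

lemma sum_const_add:
  "(\<Sum>i<m + n. x) = (\<Sum>i<m. x) + (\<Sum>i<n::nat. x)" for x :: "'b::comm_monoid_add"
  by (induction n) (simp_all add: ac_simps)

lemma poly_map_poly_to_ac: "poly (map_poly to_ac p) (to_ac x) = to_ac (poly p x)"
  by (induction p) (simp_all add: map_poly_pCons)

lemma valuation_poly_eventually:
  assumes v: "is_valuation v" and u: "extends_valuation u v" and s: "pseudo_convergent v s"
    and g: "\<And>n. v (s (Suc n) - s n) = Fin (g n)" and p: "p \<noteq> 0"
  shows "\<exists>c k. \<forall>\<^sub>\<infinity>n. v (poly p (s n)) = Fin (c + (\<Sum>i<(k::nat). g n))"
proof -
  have u': "is_valuation u" and uv: "u (to_ac x) = v x" for x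
    using u by (auto simp: extends_valuation_def)
  \<comment> \<open>Induction on the multiset of roots: each linear factor adds its constant and its
    multiple of \<open>g n\<close>.\<close>
  have roots: "\<exists>c k. \<forall>\<^sub>\<infinity>n. u (poly (\<Prod>x\<in>#A. [:-x, 1:]) (to_ac (s n))) = Fin (c + (\<Sum>i<(k::nat). g n))"
    for A
  proof (induction A)
    case empty
    then show ?case
      by (intro exI[of _ 0] exI[of _ 0]) (simp add: valuation_one[OF u'] zero_extended_def)
  next
    case (add \<alpha> A)
    then obtain c k where 1:
      "\<forall>\<^sub>\<infinity>n. u (poly (\<Prod>x\<in>#A. [:-x, 1:]) (to_ac (s n))) = Fin (c + (\<Sum>i<(k::nat). g n))" by blast
    obtain d l where 2: "\<forall>\<^sub>\<infinity>n. u (to_ac (s n) - \<alpha>) = Fin (d + (\<Sum>i<(l::nat). g n))"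
      using valuation_at_root_eventually[OF v u s, where g = g and \<alpha> = \<alpha>] g by blast
    have "\<forall>\<^sub>\<infinity>n. u (poly (\<Prod>x\<in>#add_mset \<alpha> A. [:-x, 1:]) (to_ac (s n))) =
        Fin ((d + c) + (\<Sum>i<l + k. g n))"
      using 1 2
    proof eventually_elim
      case (elim n)
      have "poly (\<Prod>x\<in>#add_mset \<alpha> A. [:-x, 1:]) (to_ac (s n)) =
          (to_ac (s n) - \<alpha>) * poly (\<Prod>x\<in>#A. [:-x, 1:]) (to_ac (s n))"
        by (simp add: algebra_simps)
      then show ?case
        by (simp only: valuation_mult[OF u'] elim plus_extended.simps sum_const_add ac_simps)
    qed
    then show ?case by blast
  qed
  have nz: "map_poly to_ac p \<noteq> 0" using p by (simp add: poly_eq_iff coeff_map_poly)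
  from alg_closed_imp_factorization[OF this] obtain A where A: "map_poly to_ac p =
      smult (lead_coeff (map_poly to_ac p)) (\<Prod>x\<in>#A. [:-x, 1:])"
    by blast
  from nz have "lead_coeff (map_poly to_ac p) \<noteq> 0" by simp
  then obtain b where b: "u (lead_coeff (map_poly to_ac p)) = Fin b"
    by (rule valuation_FinE[OF u'])
  obtain c k where
    "\<forall>\<^sub>\<infinity>n. u (poly (\<Prod>x\<in>#A. [:-x, 1:]) (to_ac (s n))) = Fin (c + (\<Sum>i<(k::nat). g n))"
    using roots by blast
  then have "\<forall>\<^sub>\<infinity>n. v (poly p (s n)) = Fin ((b + c) + (\<Sum>i<k. g n))"
  proof eventually_elim
    case (elim n)
    have "v (poly p (s n)) = u (poly (map_poly to_ac p) (to_ac (s n)))"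
      by (simp add: poly_map_poly_to_ac uv)
    also have "\<dots> = Fin b + Fin (c + (\<Sum>i<k. g n))"
      by (subst A) (simp only: poly_smult valuation_mult[OF u'] b elim)
    finally show ?case by (simp add: ac_simps)
  qed
  then show ?thesis by blast
qed

text \<open>With \<open>k \<le> l\<close>, cancelling \<open>k\<close> copies of \<open>g n\<close>
  leaves \<open>c\<close> against \<open>d + j \<gamma>\<^sub>n\<close>, where
  \<open>j = l - k\<close>. The latter is monotone in \<open>n\<close>, so it either reaches
  \<open>c\<close> and stays at or above it, or always lies below \<open>c\<close>.\<close>

lemma affine_eventually_comparable:
  fixes g :: "nat \<Rightarrow> 'g::linordered_ab_group_add"
  assumes "mono g"
  shows "(\<forall>\<^sub>\<infinity>n. c + (\<Sum>i<(k::nat). g n) \<le> d + (\<Sum>i<(l::nat). g n)) \<or>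
    (\<forall>\<^sub>\<infinity>n. d + (\<Sum>i<l. g n) \<le> c + (\<Sum>i<k. g n))"
proof (induction k l arbitrary: c d rule: linorder_wlog)
  case (le k l)
  then obtain j where l: "l = k + j" by (auto simp: le_iff_add)
  have eq: "c + (\<Sum>i<k. g n) \<le> d + (\<Sum>i<l. g n) \<longleftrightarrow> c \<le> d + (\<Sum>i<j. g n)"
    "d + (\<Sum>i<l. g n) \<le> c + (\<Sum>i<k. g n) \<longleftrightarrow> d + (\<Sum>i<j. g n) \<le> c" for n
  proof -
    have "d + (\<Sum>i<l. g n) = (d + (\<Sum>i<j. g n)) + (\<Sum>i<k. g n)"
      unfolding l sum_const_add by (simp add: ac_simps)
    then show "c + (\<Sum>i<k. g n) \<le> d + (\<Sum>i<l. g n) \<longleftrightarrow> c \<le> d + (\<Sum>i<j. g n)"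
      "d + (\<Sum>i<l. g n) \<le> c + (\<Sum>i<k. g n) \<longleftrightarrow> d + (\<Sum>i<j. g n) \<le> c" by simp_all
  qed
  show ?case
  proof (cases "\<exists>N. c \<le> d + (\<Sum>i<j. g N)")
    case True
    then obtain N where N: "c \<le> d + (\<Sum>i<j. g N)" by blast
    have "c \<le> d + (\<Sum>i<j. g n)" if "n \<ge> N" for n
      using N add_left_mono[OF sum_mono[of "{..<j}" "\<lambda>_. g N" "\<lambda>_. g n"], of d]
        monoD[OF assms that] by (meson order_trans)
    then show ?thesis unfolding eq MOST_nat_le by blast
  next
    case False
    then show ?thesis unfolding eq by (simp add: not_le less_imp_le)
  qed
next
  case (sym k l)
  then show ?case by blast
qed

section \<open>The rings \<open>V\<^sub>E\<close>\<close>

text \<open>Equal fractions have equal cross products, so evaluation does not depend on the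
  representation, provided the denominator does not vanish at \<open>a\<close>.\<close>

lemma has_value_unique:
  assumes "has_value \<phi> a y" "has_value \<phi> a z"
  shows "y = z"
proof -
  obtain p q p' q' where 1: "\<phi> = Fract p q" "poly q a \<noteq> 0" "y = poly p a / poly q a"
    and 2: "\<phi> = Fract p' q'" "poly q' a \<noteq> 0" "z = poly p' a / poly q' a"
    using assms unfolding has_value_def by blast
  have "q \<noteq> 0" "q' \<noteq> 0" using 1(2) 2(2) by auto
  with 1(1) 2(1) have "p * q' = p' * q" by (simp add: eq_fract)
  then have "poly p a * poly q' a = poly p' a * poly q a" by (simp flip: poly_mult)
  then show ?thesis unfolding 1(3) 2(3) by (simp only: frac_eq_eq[OF 1(2) 2(2)])
qed

lemma has_value_FractI: "poly q a \<noteq> 0 \<Longrightarrow> has_value (Fract p q) a (poly p a / poly q a)"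
  unfolding has_value_def by blast

lemma has_value_const: "has_value (to_fract [:c:]) a c"
  using has_value_FractI[of 1 a "[:c:]"] by (simp add: to_fract_def)

lemma const_mem_V_seq:
  assumes "c \<in> V"
  shows "to_fract [:c:] \<in> V_seq V s"
proof -
  have "\<exists>y\<in>V. has_value (to_fract [:c:]) a y" for a
    using assms has_value_const by blast
  then show ?thesis by (simp add: V_seq_def)
qed

lemma has_value_add:
  assumes "has_value \<phi> a y" "has_value \<psi> a z"
  shows "has_value (\<phi> + \<psi>) a (y + z)"
proof -
  obtain p q p' q' where 1: "\<phi> = Fract p q" "poly q a \<noteq> 0" "y = poly p a / poly q a"
    and 2: "\<psi> = Fract p' q'" "poly q' a \<noteq> 0" "z = poly p' a / poly q' a"
    using assms unfolding has_value_def by blast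
  have "q \<noteq> 0" "q' \<noteq> 0" using 1(2) 2(2) by auto
  then have "\<phi> + \<psi> = Fract (p * q' + p' * q) (q * q')"
    unfolding 1(1) 2(1) by (rule add_fract)
  moreover have "y + z = poly (p * q' + p' * q) a / poly (q * q') a"
    unfolding 1(3) 2(3) by (simp add: add_frac_eq[OF 1(2) 2(2)])
  ultimately show ?thesis
    using has_value_FractI[of "q * q'" a "p * q' + p' * q"] 1(2) 2(2) by simp
qed

lemma has_value_mult:
  assumes "has_value \<phi> a y" "has_value \<psi> a z"
  shows "has_value (\<phi> * \<psi>) a (y * z)"
proof -
  obtain p q p' q' where 1: "\<phi> = Fract p q" "poly q a \<noteq> 0" "y = poly p a / poly q a"
    and 2: "\<psi> = Fract p' q'" "poly q' a \<noteq> 0" "z = poly p' a / poly q' a"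
    using assms unfolding has_value_def by blast
  have "\<phi> * \<psi> = Fract (p * p') (q * q')" unfolding 1(1) 2(1) by (rule mult_fract)
  then show ?thesis using has_value_FractI[of "q * q'" a "p * p'"] 1(2,3) 2(2,3) by simp
qed

text \<open>Translates the carrier-based notion into type class operations. Zero belongs to
  \<open>D\<close> as \<open>1 + (- 1)\<close>.\<close>

lemma subring_type_algebra_iff:
  "subring D ring_of_type_algebra \<longleftrightarrow>
    1 \<in> D \<and> (\<forall>x\<in>D. - x \<in> D) \<and> (\<forall>x\<in>D. \<forall>y\<in>D. x * y \<in> D) \<and> (\<forall>x\<in>D. \<forall>y\<in>D. x + y \<in> D)"
  (is "_ \<longleftrightarrow> ?R") for D :: "'f::field set"
proof -
  interpret R: cring "ring_of_type_algebra :: 'f ring" by (rule cring_from_type_algebra)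
  have minus: "\<ominus>\<^bsub>ring_of_type_algebra\<^esub> x = - x" for x :: 'f
    by (rule R.minus_equality) (auto simp: ring_of_type_algebra_def)
  show ?thesis
  proof
    assume "subring D ring_of_type_algebra"
    from subringE[OF this] show ?R
      by (auto simp: minus) (auto simp: ring_of_type_algebra_def)
  next
    assume ?R
    then show "subring D ring_of_type_algebra"
      by (intro R.subringI) (unfold minus, auto simp: ring_of_type_algebra_def)
  qed
qed

lemma V_seq_valuation_domain:
  assumes V: "valuation_domain V" and Vv: "associated_valuation V v"
    and u: "extends_valuation u v" and s: "pseudo_convergent v s"
  shows "valuation_domain (V_seq V s)"
proof -
  have v: "is_valuation v" and V_def: "V = {x. 0 \<le> v x}"
    using Vv by (auto simp: associated_valuation_def)
  have ring: "1 \<in> V" "\<And>x. x \<in> V \<Longrightarrow> - x \<in> V" "\<And>x y. x \<in> V \<Longrightarrow> y \<in> V \<Longrightarrow> x * y \<in> V"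
    "\<And>x y. x \<in> V \<Longrightarrow> y \<in> V \<Longrightarrow> x + y \<in> V"
    using V by (auto simp: valuation_domain_def subring_type_algebra_iff)
  have mult: "\<phi> * \<psi> \<in> V_seq V s" if "\<phi> \<in> V_seq V s" "\<psi> \<in> V_seq V s" for \<phi> \<psi>
    using that unfolding V_seq_def mem_Collect_eq
    by eventually_elim (blast intro: has_value_mult ring)
  have add: "\<phi> + \<psi> \<in> V_seq V s" if "\<phi> \<in> V_seq V s" "\<psi> \<in> V_seq V s" for \<phi> \<psi>
    using that unfolding V_seq_def mem_Collect_eq
    by eventually_elim (blast intro: has_value_add ring)
  have one: "1 \<in> V_seq V s" using const_mem_V_seq[OF ring(1)] by (simp flip: one_pCons)
  have uminus: "- \<phi> \<in> V_seq V s" if "\<phi> \<in> V_seq V s" for \<phi>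
  proof -
    have "to_fract [:- 1 :: 'a:] = - 1" by (simp add: to_fract_def One_fract_def one_pCons)
    then show ?thesis using mult[OF const_mem_V_seq[OF ring(2)[OF ring(1)]] that] by simp
  qed
  have "\<phi> \<in> V_seq V s \<or> inverse \<phi> \<in> V_seq V s" if nz: "\<phi> \<noteq> 0" for \<phi>
  proof -
    obtain p q where \<phi>: "\<phi> = Fract p q" "p \<noteq> 0" "q \<noteq> 0"
      using nz by (cases \<phi> rule: Fract_cases_nonzero) simp_all
    obtain g where g: "mono g" "\<And>n. v (s (Suc n) - s n) = Fin (g n)"
      using pseudo_convergent_gauge_FinE[OF v s] by blast
    obtain c k where p: "\<forall>\<^sub>\<infinity>n. v (poly p (s n)) = Fin (c + (\<Sum>i<(k::nat). g n))"
      using valuation_poly_eventually[OF v u s _ \<phi>(2), where g = g] g(2) by blast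
    obtain d l where q: "\<forall>\<^sub>\<infinity>n. v (poly q (s n)) = Fin (d + (\<Sum>i<(l::nat). g n))"
      using valuation_poly_eventually[OF v u s _ \<phi>(3), where g = g] g(2) by blast
    \<comment> \<open>A finite value of \<open>h\<close> at \<open>a\<close> means that
      \<open>h\<close> does not vanish there, so the quotient is defined at
      \<open>a\<close>.\<close>
    have mem: "\<exists>y\<in>V. has_value (Fract f h) a y"
      if "v (poly f a) = Fin x" "v (poly h a) = Fin z" "z \<le> x" for f h a x z
    proof -
      have "poly h a \<noteq> 0" using that(2) valuation_zero[OF v] by auto
      then show ?thesis
        using has_value_FractI[of h a f] valuation_div_nonneg_iff[OF v, of "poly h a" "poly f a"] that
        by (auto simp: V_def)
    qed
    from affine_eventually_comparable[OF g(1), of c k d l] show ?thesis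
    proof
      assume "\<forall>\<^sub>\<infinity>n. c + (\<Sum>i<k. g n) \<le> d + (\<Sum>i<l. g n)"
      with p q have "\<forall>\<^sub>\<infinity>n. \<exists>y\<in>V. has_value (Fract q p) (s n) y"
        by eventually_elim (blast intro: mem)
      then show ?thesis by (simp add: V_seq_def \<phi>)
    next
      assume "\<forall>\<^sub>\<infinity>n. d + (\<Sum>i<l. g n) \<le> c + (\<Sum>i<k. g n)"
      with p q have "\<forall>\<^sub>\<infinity>n. \<exists>y\<in>V. has_value (Fract p q) (s n) y"
        by eventually_elim (blast intro: mem)
      then show ?thesis by (simp add: V_seq_def \<phi>)
    qed
  qed
  then show ?thesis
    using one uminus mult add by (auto simp: valuation_domain_def subring_type_algebra_iff)
qed

lemma V_seq_in_Zar:
  assumes "valuation_domain V" "associated_valuation V v" "extends_valuation u v"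
    "pseudo_convergent v s"
  shows "V_seq V s \<in> Zar V"
  using V_seq_valuation_domain[OF assms] const_mem_V_seq by (auto simp: Zar_def)

text \<open>Membership in the subbasic open set of this linear function says that the sequence
  eventually stays in the closed ball of radius \<open>v c\<close> about \<open>a\<close>.\<close>

lemma Fract_linear_mem_V_seq_iff:
  assumes Vv: "associated_valuation V v" and c: "c \<noteq> 0"
  shows "Fract [:- a, 1:] [:c:] \<in> V_seq V s \<longleftrightarrow> (\<forall>\<^sub>\<infinity>n. v c \<le> v (s n - a))"
proof -
  have v: "is_valuation v" and V_def: "V = {x. 0 \<le> v x}"
    using Vv by (auto simp: associated_valuation_def)
  have "has_value (Fract [:- a, 1:] [:c:]) x ((x - a) / c)" for x
    using has_value_FractI[of "[:c:]" x "[:- a, 1:]"] c by simp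
  then have "(\<exists>y\<in>V. has_value (Fract [:- a, 1:] [:c:]) x y) \<longleftrightarrow> v c \<le> v (x - a)" for x
    using has_value_unique valuation_div_nonneg_iff[OF v c, of "x - a"] unfolding V_def by blast
  then show ?thesis by (simp add: V_seq_def)
qed

section \<open>Closedness in the Zariski topology\<close>

theorem proposition4p2:
  fixes V :: "'a::field set"
    and v :: "'a \<Rightarrow> 'g::linordered_ab_group_add extended"
    and u :: "'a alg_closure \<Rightarrow> 'g extended"
    and \<beta> :: "'a alg_closure"
  assumes "valuation_domain V"
    and "valuation_rank V = 1"
    and "associated_valuation V v"
    and "extends_valuation u v"
  shows "closedin (pc_topology V v) (pc_extensions_at V v u \<beta>)"
proof -
  have v: "is_valuation v" and u: "is_valuation u" and uv: "u (to_ac x) = v x" for x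
    using assms(3,4) by (auto simp: associated_valuation_def extends_valuation_def)
  have "Zar V = {W \<in> Zar V. 1 \<in> W}"
    by (auto simp: Zar_def valuation_domain_def subring_type_algebra_iff)
  then have "\<Union> {{W \<in> Zar V. \<phi> \<in> W} | \<phi>. True} = Zar V"
    by blast
  then have "topspace (zariski_topology V) = Zar V"
    unfolding zariski_topology_def by simp
  \<comment> \<open>A subtopology only sees points of the ambient space; none are lost because every
    \<open>V\<^sub>E\<close> is a valuation domain containing \<open>V\<close>.\<close>
  then have top: "topspace (pc_topology V v) = pc_extensions V v"
    using V_seq_in_Zar[OF assms(1,3,4)] by (auto simp: pc_topology_def pc_extensions_def)
  have sub: "pc_extensions_at V v u \<beta> \<subseteq> pc_extensions V v"
    by (auto simp: pc_extensions_at_def pc_extensions_def)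
  have "openin (pc_topology V v) (pc_extensions V v - pc_extensions_at V v u \<beta>)"
  proof (subst openin_subopen, intro ballI)
    fix W assume W: "W \<in> pc_extensions V v - pc_extensions_at V v u \<beta>"
    then obtain s where s: "W = V_seq V s" "pseudo_convergent v s"
      by (auto simp: pc_extensions_def)
    with W have "\<beta> \<notin> pseudo_limits u s" by (auto simp: pc_extensions_at_def)
    note gauge_less = strict_monoD[OF pseudo_convergent_gauge_strict_mono[OF v s(2)] lessI]
    \<comment> \<open>The gauges increase strictly, so the first alternative of the dichotomy would
      make \<open>\<beta>\<close> a pseudo-limit; the second one remains.\<close>
    have "\<beta> \<in> pseudo_limits u s" if "\<forall>n. u (\<beta> - to_ac (s n)) = v (s (Suc n) - s n)"
      using that gauge_less by (simp add: pseudo_limits_def)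
    with \<open>\<beta> \<notin> pseudo_limits u s\<close> obtain n where n: "u (\<beta> - to_ac (s n)) < v (s (Suc n) - s n)"
      using pseudo_limit_dichotomy[OF v assms(4) s(2), of \<beta>] by blast
    define c where "c = s (Suc n) - s n"
    have c: "c \<noteq> 0"
      using gauge_less[of n] valuation_zero[OF v] by (auto simp: c_def)
    \<comment> \<open>The ball of radius \<open>\<gamma>\<^sub>n\<close> about
      \<open>s\<^sub>n\<close> contains the tail of \<open>s\<close> but not \<open>\<beta>\<close>;
      \<open>\<phi>\<close> tests whether a sequence ends up in it.\<close>
    define \<phi> where "\<phi> = Fract [:- s n, 1:] [:c:]"
    define T where "T = {W \<in> Zar V. \<phi> \<in> W} \<inter> pc_extensions V v"
    have "openin (pc_topology V v) T"
      unfolding pc_topology_def T_def zariski_topology_def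
      by (rule openin_subtopology_Int, rule topology_generated_by_Basis) blast
    moreover have "W \<in> T"
    proof -
      have "\<forall>\<^sub>\<infinity>m. v c \<le> v (s m - s n)"
        using pseudo_convergent_diff[OF v s(2), of n] unfolding MOST_nat c_def by (metis order_refl)
      then have "\<phi> \<in> W" by (simp add: s(1) \<phi>_def Fract_linear_mem_V_seq_iff[OF assms(3) c])
      then show ?thesis using V_seq_in_Zar[OF assms(1,3,4) s(2)] W s(1) by (simp add: T_def)
    qed
    \<comment> \<open>Different sequences may define the same ring, so the exclusion is shown for
      every \<open>t\<close> that has \<open>\<beta>\<close> as a pseudo-limit.\<close>
    moreover have "V_seq V t \<notin> T" if t: "\<beta> \<in> pseudo_limits u t" for t
    proof
      assume "V_seq V t \<in> T"
      then have "\<forall>\<^sub>\<infinity>m. v c \<le> v (t m - s n)"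
        by (simp add: T_def \<phi>_def Fract_linear_mem_V_seq_iff[OF assms(3) c])
      then obtain N where N: "v c \<le> v (t m - s n)" if "m \<ge> N" for m unfolding MOST_nat_le by blast
      \<comment> \<open>Once \<open>t\<^sub>m\<close> is in the ball,
        \<open>s\<^sub>n - t\<^sub>m\<close> has larger value than
        \<open>\<beta> - s\<^sub>n\<close> and does not affect the sum.\<close>
      have const: "u (\<beta> - to_ac (t m)) = u (\<beta> - to_ac (s n))" if "m \<ge> N" for m
      proof -
        have "u (\<beta> - to_ac (s n)) < u (to_ac (s n - t m))"
          using n N[OF that] valuation_minus_commute[OF v, of "t m"]
          by (simp add: uv c_def del: to_ac_diff)
        from valuation_add_eq_left[OF u this] show ?thesis by simp
      qed
      from t have "u (\<beta> - to_ac (t N)) < u (\<beta> - to_ac (t (N + 1)))" by (simp add: pseudo_limits_def)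
      then show False using const[of N] const[of "N + 1"] by simp
    qed
    then have "T \<inter> pc_extensions_at V v u \<beta> = {}"
      unfolding pc_extensions_at_def by blast
    then have "T \<subseteq> pc_extensions V v - pc_extensions_at V v u \<beta>"
      unfolding T_def by blast
    ultimately show "\<exists>T. openin (pc_topology V v) T \<and> W \<in> T \<and>
        T \<subseteq> pc_extensions V v - pc_extensions_at V v u \<beta>"
      by (intro exI[of _ T] conjI)
  qed
  then show ?thesis using sub by (simp add: closedin_def top)
qed

end
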